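(* Let $\{(\boldsymbol{\phi}^{(t)},\lambda^{(t)})\}_{t\ge 0}$ be a sequence generated by the FSEG algorithm (forward stagewise with embedded gradient descent steps, described in full in the context) with step size $\epsilon>0$ and tolerance parameter $\xi>0$, applied to the objective $\Gamma(\boldsymbol{\phi};\lambda)=\mathcal{L}(\boldsymbol{S},\boldsymbol{\phi}_C)+\lambda\,\mathcal{R}(\boldsymbol{S})$. Then for any iteration $t$ (that is, any $t$ for which the algorithm produces $(\boldsymbol{\phi}^{(t+1)},\lambda^{(t+1)})$ from $(\boldsymbol{\phi}^{(t)},\lambda^{(t)})$), the value of the objective function is improved by at least $\xi$: $$\Gamma(\boldsymbol{\phi}^{(t+1)};\lambda^{(t+1)})\le \Gamma(\boldsymbol{\phi}^{(t)};\lambda^{(t)})-\xi .$$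
   Context: **Objective.** Data $\boldsymbol{x}_1,\dots,\boldsymbol{x}_N\in\mathbb{R}^p$ and $\boldsymbol{y}\in\mathbb{R}^N$ are given. For a $q\times p$ real matrix $\boldsymbol{S}$ put $d_S(\boldsymbol{x}_i,\boldsymbol{x}_j)=\|\boldsymbol{S}(\boldsymbol{x}_i-\boldsymbol{x}_j)\|_2$. Let $c_{iso}(\cdot;\boldsymbol{\theta})$ be a stationary covariance function (a function of distance) with parameter(s) $\boldsymbol{\theta}$, and let $\boldsymbol{C}_{\boldsymbol{S},\boldsymbol{\theta}}$ be the $N\times N$ matrix with $(i,j)$ entry $c_{iso}(d_S(\boldsymbol{x}_i,\boldsymbol{x}_j);\boldsymbol{\theta})$. Let $\sigma^2$ be a noise variance and $\boldsymbol{\phi}_C=\{\boldsymbol{\theta},\sigma^2\}$. The negative log likelihood is $$\mathcal{L}(\boldsymbol{S},\boldsymbol{\phi}_C)=\tfrac12\boldsymbol{y}^T(\sigma^2\boldsymbol{I}+\boldsymbol{C}_{\boldsymbol{S},\boldsymbol{\theta}})^{-1}\boldsymbol{y}+\tfrac12\log|\sigma^2\boldsymbol{I}+\boldsymbol{C}_{\boldsymbol{S},\boldsymbol{\theta}}|,$$ which is in general a non-convex function. The sparsity penalty $\mathcal{R}(\boldsymbol{S})\ge 0$ is the entrywise $r$-norm of $\boldsymbol{S}$ for a fixed $r\le 1$ (e.g. $\mathcal{R}(\boldsymbol{S})=\sum_{l,m}|S_{lm}|$ for $r=1$). Let $\boldsymbol{\phi}\in\mathbb{R}^J$ be the vector whose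 first $q\times p$ coordinates are the entries of $\boldsymbol{S}$ and whose remaining coordinates are the entries of $\boldsymbol{\phi}_C$; write $\boldsymbol{S}^{(t)},\boldsymbol{\phi}_C^{(t)}$ for the corresponding parts of $\boldsymbol{\phi}^{(t)}$. Define $\Gamma(\boldsymbol{\phi};\lambda)=\mathcal{L}(\boldsymbol{S},\boldsymbol{\phi}_C)+\lambda\mathcal{R}(\boldsymbol{S})$, with the convention $\infty\cdot 0=0$ when $\lambda=\infty$. Let $\boldsymbol{e}_j\in\mathbb{R}^J$ denote the $j$th standard basis vector. **FSEG algorithm.** Inputs: rank $q$, step size $\epsilon>0$, tolerance $\xi>0$, and a maximum number of iterations. *Initialization.* $\boldsymbol{S}^{(0)}=\boldsymbol{0}$, $\boldsymbol{\phi}_C^{(0)}=\arg\min_{\boldsymbol{\phi}_C}\mathcal{L}(\boldsymbol{0},\boldsymbol{\phi}_C)$, $\lambda^{(0)}=\infty$. *Iteration from $(\boldsymbol{\phi}^{(t)},\lambda^{(t)})$.* 1. (Coordinate descent step.) Let $(j_b,s_b)=\arg\min_{j\in\{1,\dots,J\},\,|s|=\epsilon}\Gamma(\boldsymbol{\phi}^{(t)}+s\boldsymbol{e}_j;\lambda^{(t)})$. If $\Gamma(\boldsymbol{\phi}^{(t)};\lambda^{(t)})-\Gamma(\boldsymbol{\phi}^{(t)}+s_b\boldsymbol{e}_{j_b};\lambda^{(t)})\ge\xi$, set $\boldsymbol{\phi}^{(t+1)}=\boldsymbol{\phi}^{(t)}+s_b\boldsymbol{e}_{j_b}$ and $\lambda^{(t+1)}=\lambda^{(t)}$,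 and end the iteration. 2. Otherwise, if $\lambda^{(t)}=0$, stop the procedure. 3. (Support-limited gradient step.) Otherwise, compute $\boldsymbol{\phi}^{(t+1/2)}=\boldsymbol{\phi}^{(t)}-\epsilon_g\nabla_{\mathrm{supp}}\Gamma(\boldsymbol{\phi}^{(t)};\lambda^{(t)})$, where $\epsilon_g$ is a step size (chosen e.g. by line search) and $\nabla_{\mathrm{supp}}\Gamma(\boldsymbol{\phi}^{(t)};\lambda^{(t)})\in\mathbb{R}^J$ has $j$th entry $\partial\Gamma/\partial\phi_j$ evaluated at $(\boldsymbol{\phi}^{(t)},\lambda^{(t)})$ if $\phi_j^{(t)}\ne0$ and $0$ if $\phi_j^{(t)}=0$. If $\Gamma(\boldsymbol{\phi}^{(t)};\lambda^{(t)})-\Gamma(\boldsymbol{\phi}^{(t+1/2)};\lambda^{(t)})\ge\xi$, set $\boldsymbol{\phi}^{(t+1)}=\boldsymbol{\phi}^{(t+1/2)}$ and $\lambda^{(t+1)}=\lambda^{(t)}$, and end the iteration. 4. (Forward step.) Otherwise, let $(j_f,s_f)=\arg\min_{j\in\{1,\dots,q\times p\},\,|s|=\epsilon}\Gamma(\boldsymbol{\phi}^{(t)}+s\boldsymbol{e}_j;0)$, set $\boldsymbol{\phi}^{(t+1)}=\boldsymbol{\phi}^{(t)}+s_f\boldsymbol{e}_{j_f}$, and set $$\lambda^{(t+1)}=\min\left\{\lambda^{(t)},\ \frac{\mathcal{L}(\boldsymbol{S}^{(t)},\boldsymbol{\phi}_C^{(t)})-\mathcal{L}(\boldsymbol{S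}^{(t+1)},\boldsymbol{\phi}_C^{(t+1)})-\xi}{\mathcal{R}(\boldsymbol{S}^{(t+1)})-\mathcal{R}(\boldsymbol{S}^{(t)})}\right\}.$$
   Formalization: If iteration t is a forward step, it is additionally assumed that R(S^(t)) < R(S^(t+1)); otherwise the update of λ divides by zero or the claimed improvement by ξ fails. *)

theory Defs
  imports "HOL-Analysis.Analysis"
begin

subsection \<open>Gaussian process likelihood\<close>

definition covariance_function :: "('a \<Rightarrow> 'a \<Rightarrow> real) \<Rightarrow> bool" where
  "covariance_function K \<longleftrightarrow>
     (\<forall>u v. K u v = K v u) \<and>
     (\<forall>U a. finite U \<longrightarrow> 0 \<le> (\<Sum>u\<in>U. \<Sum>v\<in>U. a u * a v * K u v))"

definition cov_matrix ::
    "(real^'k \<Rightarrow> real \<Rightarrow> real) \<Rightarrow> ('n \<Rightarrow> real^'p) \<Rightarrow> real^'p^'q \<Rightarrow> real^'k \<Rightarrow> real^'n^'n" where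
  "cov_matrix c x S \<theta> = (\<chi> i j. c \<theta> (norm (S *v (x i - x j))))"

definition neg_log_lik ::
    "(real^'k \<Rightarrow> real \<Rightarrow> real) \<Rightarrow> ('n \<Rightarrow> real^'p) \<Rightarrow> real^'n \<Rightarrow>
     real^'p^'q \<Rightarrow> real^'k \<Rightarrow> real \<Rightarrow> real" where
  "neg_log_lik c x y S \<theta> v =
     (let K = v *\<^sub>R mat 1 + cov_matrix c x S \<theta>
      in 1/2 * (y \<bullet> (matrix_inv K *v y)) + 1/2 * ln (det K))"

text \<open>For \<open>r = 0\<close> the entrywise ``norm'' counts the nonzero entries. For \<open>r < 0\<close> the convention
  \<open>0 powr r = 0\<close> makes the sum range over the nonzero entries only.\<close>

definition entrywise_norm :: "real \<Rightarrow> real^'p^'q \<Rightarrow> real" where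
  "entrywise_norm r S =
     (if r = 0 then real (card {(l, m). S $ l $ m \<noteq> 0})
      else (\<Sum>l\<in>UNIV. \<Sum>m\<in>UNIV. \<bar>S $ l $ m\<bar> powr r) powr (1 / r))"

text \<open>The vector of all parameters is indexed by the type \<open>('q \<times> 'p) + 'k option\<close>, which has
  \<open>q p + k + 1\<close> elements: \<open>Inl (l, m)\<close> is the entry \<open>(l, m)\<close> of \<open>S\<close>, \<open>Inr (Some i)\<close> is the
  \<open>i\<close>th component of \<open>\<theta>\<close>, and \<open>Inr None\<close> is the noise variance.\<close>

type_synonym ('q, 'p, 'k) params = "real ^ (('q \<times> 'p) + 'k option)"

definition S_of :: "('q::finite, 'p::finite, 'k::finite) params \<Rightarrow> real^'p^'q" where
  "S_of \<phi> = (\<chi> l m. \<phi> $ Inl (l, m))"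

definition theta_of :: "('q::finite, 'p::finite, 'k::finite) params \<Rightarrow> real^'k" where
  "theta_of \<phi> = (\<chi> i. \<phi> $ Inr (Some i))"

definition noise_of :: "('q::finite, 'p::finite, 'k::finite) params \<Rightarrow> real" where
  "noise_of \<phi> = \<phi> $ Inr None"

definition gp_domain :: "(real^'k) set \<Rightarrow> ('q::finite, 'p::finite, 'k::finite) params set" where
  "gp_domain \<Theta> = {\<phi>. theta_of \<phi> \<in> \<Theta> \<and> 0 < noise_of \<phi>}"

definition gp_loss ::
    "(real^'k \<Rightarrow> real \<Rightarrow> real) \<Rightarrow> ('n \<Rightarrow> real^'p) \<Rightarrow> real^'n \<Rightarrow>
     ('q::finite, 'p::finite, 'k::finite) params \<Rightarrow> real" where
  "gp_loss c x y \<phi> = neg_log_lik c x y (S_of \<phi>) (theta_of \<phi>) (noise_of \<phi>)"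

definition gp_penalty :: "real \<Rightarrow> ('q::finite, 'p::finite, 'k::finite) params \<Rightarrow> real" where
  "gp_penalty r \<phi> = entrywise_norm r (S_of \<phi>)"

subsection \<open>The FSEG algorithm\<close>

text \<open>The algorithm is defined for a loss \<open>L\<close>, a penalty \<open>R\<close> and a domain \<open>D\<close> of admissible
  parameter vectors; the penalised coordinates are those of the form \<open>Inl a\<close>. The objective is
  infinite outside \<open>D\<close>, so all minimisations below are over admissible vectors. On \<^typ>\<open>ereal\<close> we
  have \<open>\<infinity> * 0 = 0\<close>.\<close>

definition objective ::
    "(real^'j) set \<Rightarrow> (real^'j \<Rightarrow> real) \<Rightarrow> (real^'j \<Rightarrow> real) \<Rightarrow> real^'j \<Rightarrow> ereal \<Rightarrow> ereal" where
  "objective D L R \<phi> lam = (if \<phi> \<in> D then ereal (L \<phi>) + lam * ereal (R \<phi>) else \<infinity>)"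

definition move :: "real^'j \<Rightarrow> 'j \<times> real \<Rightarrow> real^'j" where
  "move \<phi> = (\<lambda>(j, s). \<phi> + s *\<^sub>R axis j 1)"

definition supp_gradient ::
    "(real^'j) set \<Rightarrow> (real^'j \<Rightarrow> real) \<Rightarrow> (real^'j \<Rightarrow> real) \<Rightarrow> real^'j \<Rightarrow> ereal \<Rightarrow> real^'j" where
  "supp_gradient D L R \<phi> lam =
     (\<chi> j. if \<phi> $ j \<noteq> 0
           then deriv (\<lambda>h. real_of_ereal (objective D L R (move \<phi> (j, h)) lam)) 0
           else 0)"

definition improves ::
    "(real^'j) set \<Rightarrow> (real^'j \<Rightarrow> real) \<Rightarrow> (real^'j \<Rightarrow> real) \<Rightarrow> real \<Rightarrow>
     ereal \<Rightarrow> real^'j \<Rightarrow> real^'j \<Rightarrow> bool" where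
  "improves D L R \<xi> lam \<phi> \<phi>' \<longleftrightarrow> objective D L R \<phi> lam - objective D L R \<phi>' lam \<ge> ereal \<xi>"

definition best_move ::
    "(real^'j) set \<Rightarrow> (real^'j \<Rightarrow> real) \<Rightarrow> (real^'j \<Rightarrow> real) \<Rightarrow> real \<Rightarrow>
     'j set \<Rightarrow> ereal \<Rightarrow> real^'j \<Rightarrow> 'j \<times> real \<Rightarrow> bool" where
  "best_move D L R \<epsilon> J lam \<phi> =
     is_arg_min (\<lambda>m. objective D L R (move \<phi> m) lam) (\<lambda>(j, s). j \<in> J \<and> \<bar>s\<bar> = \<epsilon>)"

definition coordinate_iteration ::
    "(real^'j) set \<Rightarrow> (real^'j \<Rightarrow> real) \<Rightarrow> (real^'j \<Rightarrow> real) \<Rightarrow> real \<Rightarrow> real \<Rightarrow>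
     real^'j \<Rightarrow> ereal \<Rightarrow> real^'j \<Rightarrow> ereal \<Rightarrow> bool" where
  "coordinate_iteration D L R \<epsilon> \<xi> \<phi> lam \<phi>' lam' \<longleftrightarrow>
     (\<exists>m. best_move D L R \<epsilon> UNIV lam \<phi> m \<and> improves D L R \<xi> lam \<phi> (move \<phi> m) \<and>
          \<phi>' = move \<phi> m \<and> lam' = lam)"

definition coordinate_fails ::
    "(real^'j) set \<Rightarrow> (real^'j \<Rightarrow> real) \<Rightarrow> (real^'j \<Rightarrow> real) \<Rightarrow> real \<Rightarrow> real \<Rightarrow>
     real^'j \<Rightarrow> ereal \<Rightarrow> bool" where
  "coordinate_fails D L R \<epsilon> \<xi> \<phi> lam \<longleftrightarrow>
     (\<exists>m. best_move D L R \<epsilon> UNIV lam \<phi> m \<and> \<not> improves D L R \<xi> lam \<phi> (move \<phi> m))"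

text \<open>The step size \<open>\<eta>\<close> of the gradient step is left open: any positive number, possibly a
  different one in each iteration.\<close>

definition gradient_iteration ::
    "(real^'j) set \<Rightarrow> (real^'j \<Rightarrow> real) \<Rightarrow> (real^'j \<Rightarrow> real) \<Rightarrow> real \<Rightarrow> real \<Rightarrow>
     real^'j \<Rightarrow> ereal \<Rightarrow> real^'j \<Rightarrow> ereal \<Rightarrow> bool" where
  "gradient_iteration D L R \<epsilon> \<xi> \<phi> lam \<phi>' lam' \<longleftrightarrow>
     coordinate_fails D L R \<epsilon> \<xi> \<phi> lam \<and> lam \<noteq> 0 \<and>
     (\<exists>\<eta>>0. let \<phi>h = \<phi> - \<eta> *\<^sub>R supp_gradient D L R \<phi> lam
            in improves D L R \<xi> lam \<phi> \<phi>h \<and> \<phi>' = \<phi>h \<and> lam' = lam)"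

definition forward_iteration ::
    "(real^('a::finite + 'b::finite)) set \<Rightarrow> (real^('a + 'b) \<Rightarrow> real) \<Rightarrow> (real^('a + 'b) \<Rightarrow> real) \<Rightarrow>
     real \<Rightarrow> real \<Rightarrow> real^('a + 'b) \<Rightarrow> ereal \<Rightarrow> real^('a + 'b) \<Rightarrow> ereal \<Rightarrow> bool" where
  "forward_iteration D L R \<epsilon> \<xi> \<phi> lam \<phi>' lam' \<longleftrightarrow>
     coordinate_fails D L R \<epsilon> \<xi> \<phi> lam \<and> lam \<noteq> 0 \<and>
     (\<exists>\<eta>>0. \<not> improves D L R \<xi> lam \<phi> (\<phi> - \<eta> *\<^sub>R supp_gradient D L R \<phi> lam)) \<and>
     (\<exists>m. best_move D L R \<epsilon> (range Inl) 0 \<phi> m \<and> \<phi>' = move \<phi> m) \<and>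
     lam' = min lam (ereal ((L \<phi> - L \<phi>' - \<xi>) / (R \<phi>' - R \<phi>)))"

definition fseg_iteration ::
    "(real^('a::finite + 'b::finite)) set \<Rightarrow> (real^('a + 'b) \<Rightarrow> real) \<Rightarrow> (real^('a + 'b) \<Rightarrow> real) \<Rightarrow>
     real \<Rightarrow> real \<Rightarrow> real^('a + 'b) \<Rightarrow> ereal \<Rightarrow> real^('a + 'b) \<Rightarrow> ereal \<Rightarrow> bool" where
  "fseg_iteration D L R \<epsilon> \<xi> \<phi> lam \<phi>' lam' \<longleftrightarrow>
     coordinate_iteration D L R \<epsilon> \<xi> \<phi> lam \<phi>' lam' \<or>
     gradient_iteration D L R \<epsilon> \<xi> \<phi> lam \<phi>' lam' \<or>
     forward_iteration D L R \<epsilon> \<xi> \<phi> lam \<phi>' lam'"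

definition fseg_init ::
    "(real^('a::finite + 'b::finite)) set \<Rightarrow> (real^('a + 'b) \<Rightarrow> real) \<Rightarrow>
     real^('a + 'b) \<Rightarrow> ereal \<Rightarrow> bool" where
  "fseg_init D L \<phi> lam \<longleftrightarrow>
     is_arg_min L (\<lambda>\<psi>. \<psi> \<in> D \<and> (\<forall>a. \<psi> $ Inl a = 0)) \<phi> \<and> lam = \<infinity>"

text \<open>\<open>n\<close> is the number of iterations carried out and \<open>M\<close> the maximum number allowed. If the
  procedure stops, only the first \<open>n + 1\<close> members of the two sequences matter.\<close>

definition fseg_run ::
    "(real^('a::finite + 'b::finite)) set \<Rightarrow> (real^('a + 'b) \<Rightarrow> real) \<Rightarrow> (real^('a + 'b) \<Rightarrow> real) \<Rightarrow>
     real \<Rightarrow> real \<Rightarrow> nat \<Rightarrow> nat \<Rightarrow> (nat \<Rightarrow> real^('a + 'b)) \<Rightarrow> (nat \<Rightarrow> ereal) \<Rightarrow> bool" where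
  "fseg_run D L R \<epsilon> \<xi> M n \<phi> lam \<longleftrightarrow>
     fseg_init D L (\<phi> 0) (lam 0) \<and> n \<le> M \<and>
     (\<forall>t<n. fseg_iteration D L R \<epsilon> \<xi> (\<phi> t) (lam t) (\<phi> (Suc t)) (lam (Suc t)))"

end

theory Submission
  imports Defs
begin

text \<open>In a coordinate or gradient step the improvement is the acceptance test itself. In a forward
  step the cap on the new multiplier rearranges to
  \<open>L \<phi>' + lam' * R \<phi>' \<le> L \<phi> + lam' * R \<phi> - \<xi>\<close>, and lowering the multiplier does not raise the
  objective at \<open>\<phi>\<close>. What has to be excluded is that the acceptance test holds through
  \<open>\<infinity> - \<infinity> = \<infinity>\<close> on \<^typ>\<open>ereal\<close>; this cannot happen because the objective stays finite
  along a run.\<close>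

lemma objective_neq_MInfty:
  assumes "lam \<noteq> -\<infinity>" "0 \<le> R \<phi>"
  shows "objective D L R \<phi> lam \<noteq> -\<infinity>"
  using assms by (cases lam) (auto simp: objective_def)

text \<open>With multiplier \<infinity> the penalty term is 0 or \<infinity>, according to whether
  \<open>R \<phi>\<close> vanishes; a real multiplier always gives a real term.\<close>

lemma objective_finite_iff:
  assumes "lam \<noteq> -\<infinity>" "0 \<le> R \<phi>"
  shows "\<bar>objective D L R \<phi> lam\<bar> \<noteq> \<infinity> \<longleftrightarrow> \<phi> \<in> D \<and> (lam = \<infinity> \<longrightarrow> R \<phi> = 0)"
  using assms by (cases lam) (auto simp: objective_def)

text \<open>Finiteness at \<open>\<phi>\<close> rules out \<infinity> - \<infinity>, so the
  difference can be rearranged; a candidate with infinite objective gives -\<infinity> and fails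
  both sides.\<close>

lemma improves_iff:
  assumes "\<bar>objective D L R \<phi> lam\<bar> \<noteq> \<infinity>" "lam \<noteq> -\<infinity>" "0 \<le> R \<phi>'"
  shows "improves D L R \<xi> lam \<phi> \<phi>' \<longleftrightarrow>
           objective D L R \<phi>' lam \<le> objective D L R \<phi> lam - ereal \<xi>"
  using assms(1) objective_neq_MInfty[of lam R \<phi>' D L, OF assms(2,3)]
  by (cases "objective D L R \<phi> lam"; cases "objective D L R \<phi>' lam") (auto simp: improves_def)

lemma improves_finite:
  assumes "\<bar>objective D L R \<phi> lam\<bar> \<noteq> \<infinity>" "lam \<noteq> -\<infinity>" "0 \<le> R \<phi>'"
    and "improves D L R \<xi> lam \<phi> \<phi>'"
  shows "\<bar>objective D L R \<phi>' lam\<bar> \<noteq> \<infinity>"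
  using assms(1,4) objective_neq_MInfty[of lam R \<phi>' D L, OF assms(2,3)]
  by (cases "objective D L R \<phi> lam"; cases "objective D L R \<phi>' lam") (auto simp: improves_def)

text \<open>Coordinate and gradient iterations differ only in how the candidate is found; both keep
  the multiplier and pass the same test, so they merge into one case.\<close>

lemma fseg_iteration_cases:
  assumes "fseg_iteration D L R \<epsilon> \<xi> \<phi> lam \<phi>' lam'"
  obtains (accepted) "improves D L R \<xi> lam \<phi> \<phi>'" "lam' = lam"
  | (forward) "forward_iteration D L R \<epsilon> \<xi> \<phi> lam \<phi>' lam'"
  using assms
  by (auto simp: fseg_iteration_def coordinate_iteration_def gradient_iteration_def Let_def)

lemma forward_iterationD:
  assumes "forward_iteration D L R \<epsilon> \<xi> \<phi> lam \<phi>' lam'"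
  shows "\<exists>a s. \<phi>' = move \<phi> (Inl a, s)"
    and "lam' = min lam (ereal ((L \<phi> - L \<phi>' - \<xi>) / (R \<phi>' - R \<phi>)))"
  using assms by (auto simp: forward_iteration_def best_move_def is_arg_min_def)

lemma fseg_iteration_finite:
  assumes R: "\<And>\<psi>. 0 \<le> R \<psi>"
    and D: "\<And>\<psi> a s. \<psi> \<in> D \<Longrightarrow> move \<psi> (Inl a, s) \<in> D"
    and iter: "fseg_iteration D L R \<epsilon> \<xi> \<phi> lam \<phi>' lam'"
    and fin: "\<bar>objective D L R \<phi> lam\<bar> \<noteq> \<infinity>" "lam \<noteq> -\<infinity>"
  shows "\<bar>objective D L R \<phi>' lam'\<bar> \<noteq> \<infinity> \<and> lam' \<noteq> -\<infinity>"
  using iter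
proof (cases rule: fseg_iteration_cases)
  case accepted
  then show ?thesis using improves_finite[OF fin R] fin(2) by simp
next
  case forward
  have "\<phi>' \<in> D"
    using forward_iterationD(1)[OF forward] D fin R by (auto simp: objective_finite_iff)
  \<comment> \<open>The cap is a real number even for a zero denominator, where division yields 0.
    Hence a positive penalty at \<open>\<phi>'\<close> cannot make the objective infinite.\<close>
  moreover have "\<bar>lam'\<bar> \<noteq> \<infinity>"
    using forward_iterationD(2)[OF forward] fin(2) by (cases lam) (auto simp: min_def)
  ultimately show ?thesis using R by (cases lam') (auto simp: objective_def)
qed

lemma forward_iteration_improves:
  assumes R: "\<And>\<psi>. 0 \<le> R \<psi>"
    and D: "\<And>\<psi> a s. \<psi> \<in> D \<Longrightarrow> move \<psi> (Inl a, s) \<in> D"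
    and forward: "forward_iteration D L R \<epsilon> \<xi> \<phi> lam \<phi>' lam'"
    and fin: "\<bar>objective D L R \<phi> lam\<bar> \<noteq> \<infinity>" "lam \<noteq> -\<infinity>"
    and less: "R \<phi> < R \<phi>'"
  shows "objective D L R \<phi>' lam' \<le> objective D L R \<phi> lam - ereal \<xi>"
proof -
  define \<mu> where "\<mu> = (L \<phi> - L \<phi>' - \<xi>) / (R \<phi>' - R \<phi>)"
  have lam': "lam' = min lam (ereal \<mu>)"
    using forward_iterationD(2)[OF forward] by (simp add: \<mu>_def)
  then obtain l where l: "lam' = ereal l"
    using fin(2) by (cases lam) (auto simp: min_def split: if_splits)
  have \<phi>: "\<phi> \<in> D" and \<phi>': "\<phi>' \<in> D"
    using forward_iterationD(1)[OF forward] D fin R by (auto simp: objective_finite_iff)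
  have "l \<le> \<mu>" using lam' l by (metis ereal_less_eq(3) min.cobounded2)
  \<comment> \<open>Clearing the denominator uses \<open>less\<close>: if the penalty decreased, the
    inequality would be reversed. The sign of \<open>l\<close> does not matter.\<close>
  then have "l * (R \<phi>' - R \<phi>) \<le> L \<phi> - L \<phi>' - \<xi>"
    using less by (simp add: \<mu>_def le_divide_eq)
  then have "L \<phi>' + l * R \<phi>' \<le> L \<phi> + l * R \<phi> - \<xi>"
    by (simp add: algebra_simps)
  then have "objective D L R \<phi>' lam' \<le> objective D L R \<phi> lam' - ereal \<xi>"
    using \<phi> \<phi>' by (simp add: objective_def l)
  \<comment> \<open>This monotonicity includes \<open>lam = \<infinity>\<close>, where finiteness of
    the objective forces \<open>R \<phi> = 0\<close> and both products are 0.\<close>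
  also have "lam' * ereal (R \<phi>) \<le> lam * ereal (R \<phi>)"
    using R lam' by (intro ereal_mult_right_mono) auto
  then have "objective D L R \<phi> lam' - ereal \<xi> \<le> objective D L R \<phi> lam - ereal \<xi>"
    by (intro ereal_minus_mono) (auto simp: objective_def intro: add_left_mono)
  finally show ?thesis .
qed

lemma fseg_iteration_improves:
  assumes R: "\<And>\<psi>. 0 \<le> R \<psi>"
    and D: "\<And>\<psi> a s. \<psi> \<in> D \<Longrightarrow> move \<psi> (Inl a, s) \<in> D"
    and iter: "fseg_iteration D L R \<epsilon> \<xi> \<phi> lam \<phi>' lam'"
    and fin: "\<bar>objective D L R \<phi> lam\<bar> \<noteq> \<infinity>" "lam \<noteq> -\<infinity>"
    and less: "forward_iteration D L R \<epsilon> \<xi> \<phi> lam \<phi>' lam' \<Longrightarrow> R \<phi> < R \<phi>'"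
  shows "objective D L R \<phi>' lam' \<le> objective D L R \<phi> lam - ereal \<xi>"
  using iter
proof (cases rule: fseg_iteration_cases)
  case accepted
  then show ?thesis using improves_iff[OF fin R] by simp
next
  case forward
  then show ?thesis using forward_iteration_improves[OF R D forward fin less] by blast
qed

text \<open>Finiteness is an invariant of the run: it holds initially although the multiplier is
  \<infinity>, because \<open>R0\<close> makes the penalty 0 there, and every iteration preserves
  it.\<close>

lemma fseg_run_finite:
  assumes R: "\<And>\<psi>. 0 \<le> R \<psi>"
    and R0: "\<And>\<psi>. (\<And>a. \<psi> $ Inl a = 0) \<Longrightarrow> R \<psi> = 0"
    and D: "\<And>\<psi> a s. \<psi> \<in> D \<Longrightarrow> move \<psi> (Inl a, s) \<in> D"
    and run: "fseg_run D L R \<epsilon> \<xi> M n \<phi> lam" and "t \<le> n"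
  shows "\<bar>objective D L R (\<phi> t) (lam t)\<bar> \<noteq> \<infinity> \<and> lam t \<noteq> -\<infinity>"
  using \<open>t \<le> n\<close>
proof (induction t)
  case 0
  have "\<phi> 0 \<in> D" "R (\<phi> 0) = 0" "lam 0 = \<infinity>"
    using run R0 by (auto simp: fseg_run_def fseg_init_def is_arg_min_def)
  then show ?case by (simp add: objective_def)
next
  case (Suc t)
  then have "fseg_iteration D L R \<epsilon> \<xi> (\<phi> t) (lam t) (\<phi> (Suc t)) (lam (Suc t))"
    using run by (simp add: fseg_run_def)
  with Suc show ?case by (intro fseg_iteration_finite[OF R D]) auto
qed

lemma gp_penalty_nonneg: "0 \<le> gp_penalty r \<phi>"
  by (simp add: gp_penalty_def entrywise_norm_def)

text \<open>For \<open>r = 0\<close> no entry is counted; otherwise \<open>0 powr r = 0\<close>,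
  also for negative \<open>r\<close>, and the outer power of 0 is again 0.\<close>

lemma gp_penalty_eq_0:
  assumes "\<And>a. \<phi> $ Inl a = 0"
  shows "gp_penalty r \<phi> = 0"
  using assms by (simp add: gp_penalty_def entrywise_norm_def S_of_def)

text \<open>The domain restricts only the \<open>Inr\<close> coordinates, so a forward step, which
  changes one entry of \<open>S\<close>, cannot leave it.\<close>

lemma move_Inl_gp_domain:
  assumes "\<phi> \<in> gp_domain \<Theta>"
  shows "move \<phi> (Inl a, s) \<in> gp_domain \<Theta>"
  using assms by (simp add: gp_domain_def theta_of_def noise_of_def move_def axis_def)

theorem theorem1:
  fixes x :: "'n::finite \<Rightarrow> real^'p::finite"
    and y :: "real^'n"
    and c :: "real^'k::finite \<Rightarrow> real \<Rightarrow> real"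
    and \<Theta> :: "(real^'k) set"
    and r \<epsilon> \<xi> :: real
    and M n t :: nat
    and \<phi> :: "nat \<Rightarrow> ('q::finite, 'p, 'k) params"
    and lam :: "nat \<Rightarrow> ereal"
  defines "D \<equiv> (gp_domain \<Theta> :: ('q, 'p, 'k) params set)"
    and "L \<equiv> (gp_loss c x y :: ('q, 'p, 'k) params \<Rightarrow> real)"
    and "R \<equiv> (gp_penalty r :: ('q, 'p, 'k) params \<Rightarrow> real)"
  assumes "\<And>\<theta>. \<theta> \<in> \<Theta> \<Longrightarrow> covariance_function (\<lambda>u v :: real^'q. c \<theta> (dist u v))"
    and "r \<le> 1"
    and "0 < \<epsilon>"
    and "0 < \<xi>"
    and "fseg_run D L R \<epsilon> \<xi> M n \<phi> lam"
    and "t < n"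
    and "forward_iteration D L R \<epsilon> \<xi> (\<phi> t) (lam t) (\<phi> (Suc t)) (lam (Suc t)) \<Longrightarrow>
           R (\<phi> t) < R (\<phi> (Suc t))"
  shows "objective D L R (\<phi> (Suc t)) (lam (Suc t)) \<le> objective D L R (\<phi> t) (lam t) - ereal \<xi>"
proof -
  have R: "0 \<le> R \<psi>" and R0: "(\<And>a. \<psi> $ Inl a = 0) \<Longrightarrow> R \<psi> = 0"
    and D: "\<psi> \<in> D \<Longrightarrow> move \<psi> (Inl a, s) \<in> D" for \<psi> a s
    by (simp_all add: R_def D_def gp_penalty_nonneg gp_penalty_eq_0 move_Inl_gp_domain)
  note run = \<open>fseg_run D L R \<epsilon> \<xi> M n \<phi> lam\<close>
  have iter: "fseg_iteration D L R \<epsilon> \<xi> (\<phi> t) (lam t) (\<phi> (Suc t)) (lam (Suc t))"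
    using run \<open>t < n\<close> by (simp add: fseg_run_def)
  have fin: "\<bar>objective D L R (\<phi> t) (lam t)\<bar> \<noteq> \<infinity> \<and> lam t \<noteq> -\<infinity>"
    using \<open>t < n\<close> by (intro fseg_run_finite[OF R R0 D run]) auto
  show ?thesis
    by (rule fseg_iteration_improves[OF R D iter conjunct1[OF fin] conjunct2[OF fin]])
      (use assms(10) in auto)
qed

end
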